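(* Let $m$, $n$, and $k$ be nonnegative integers such that $m\le n$, $k\le n-m$, and $k\ge m$. Then $$N^{(m)}_{n,k}(q) = \sum_{s=0}^{k-m} q^{s(s+m)}\, N^{(m)}_{k,s}(q) \begin{bmatrix} n+k-s-m\\ 2k\end{bmatrix}_q.$$
   Context: $q$ is an indeterminate. $[i]_q=\frac{1-q^i}{1-q}$, $[k]_q!=\prod_{i=1}^k [i]_q$, and $\begin{bmatrix} n\\k\end{bmatrix}_q=\frac{[n]_q!}{[k]_q![n-k]_q!}$ for $0\le k\le n$, with $\begin{bmatrix} n\\k\end{bmatrix}_q=0$ if $k>n\ge 0$. For nonnegative integers $m\le n$ and $k\le n-m$, the $q$-$m$-Narayana numbers are $N^{(m)}_{n,k}(q)=\begin{bmatrix} 2m\\ m\end{bmatrix}_q\begin{bmatrix} n\\ m\end{bmatrix}_q^{-1}\begin{bmatrix} n\\ k\end{bmatrix}_q\begin{bmatrix} n\\ k+m\end{bmatrix}_q$. *)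

theory Defs
  imports "HOL-Computational_Algebra.Computational_Algebra"
begin

definition q_int :: "'a::field \<Rightarrow> nat \<Rightarrow> 'a" where
  "q_int q i = (1 - q ^ i) / (1 - q)"

definition q_fact :: "'a::field \<Rightarrow> nat \<Rightarrow> 'a" where
  "q_fact q k = (\<Prod>i=1..k. q_int q i)"

definition q_binomial :: "'a::field \<Rightarrow> nat \<Rightarrow> nat \<Rightarrow> 'a" where
  "q_binomial q n k = (if k \<le> n then q_fact q n / (q_fact q k * q_fact q (n - k)) else 0)"

(* The q-m-Narayana number; the argument order is q, m, n, k. Only meaningful for m <= n
   and k <= n - m. *)
definition q_narayana :: "'a::field \<Rightarrow> nat \<Rightarrow> nat \<Rightarrow> nat \<Rightarrow> 'a" where
  "q_narayana q m n k =
     q_binomial q (2 * m) m * inverse (q_binomial q n m) *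
     q_binomial q n k * q_binomial q n (k + m)"

(* The indeterminate, as an element of the field of rational functions over the rationals.
   Since it is transcendental, none of the denominators above vanishes at it. *)
definition q_indet :: "rat poly fract" where
  "q_indet = to_fract [:0, 1:]"

end

(* After cancelling common factors the claim is the instance x = n, u = v = k, b = k - m of the
   q-Pfaff-Saalschuetz identity
     [x, u+v-b] [x+b-u, b] = sum_s q^(s(v-b+s)) [u, s] [v, b-s] [x+b-s, u+v].
   To prove it, expand [x+b-s, u+v] by q-Vandermonde as a sum over t and exchange the sums; the
   sum over s and then the sum over t are again q-Vandermonde convolutions. *)

theory Submission
  imports Defs
begin

text \<open>A \<open>q\<close> that is not a root of unity (1 included) keeps
  \<open>q_int q i\<close> nonzero for i > 0, so all denominators can be cancelled freely.\<close>

locale q_generic =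
  fixes q :: "'a::field"
  assumes q_power_neq_1: "i > 0 \<Longrightarrow> q ^ i \<noteq> 1"
begin

lemma q_int_neq_0: "i > 0 \<Longrightarrow> q_int q i \<noteq> 0"
  using q_power_neq_1[of i] q_power_neq_1[of 1] by (simp add: q_int_def)

lemma q_fact_neq_0: "q_fact q n \<noteq> 0"
  by (auto simp: q_fact_def q_int_neq_0)

lemma q_fact_0 [simp]: "q_fact q 0 = 1"
  by (simp add: q_fact_def)

lemma q_fact_Suc: "q_fact q (Suc n) = q_int q (Suc n) * q_fact q n"
  by (simp add: q_fact_def mult.commute)

lemma q_int_add: "q_int q (i + j) = q_int q i + q ^ i * q_int q j"
  using q_power_neq_1[of 1] by (simp add: q_int_def field_simps power_add)

lemma q_binomial_0 [simp]: "q_binomial q n 0 = 1"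
  by (simp add: q_binomial_def q_fact_neq_0)

lemma q_binomial_self [simp]: "q_binomial q n n = 1"
  by (simp add: q_binomial_def q_fact_neq_0)

lemma q_binomial_eq_0: "n < k \<Longrightarrow> q_binomial q n k = 0"
  by (simp add: q_binomial_def)

lemma q_binomial_neq_0: "k \<le> n \<Longrightarrow> q_binomial q n k \<noteq> 0"
  by (simp add: q_binomial_def q_fact_neq_0)

lemma q_binomial_symmetric: "k \<le> n \<Longrightarrow> q_binomial q n (n - k) = q_binomial q n k"
  by (simp add: q_binomial_def mult.commute)

text \<open>The q-Pascal rule comes from splitting the top q-integer n + 1 = (n - k) + (k + 1) with
  \<open>q_int_add\<close>. For n < k everything vanishes, so the truncated exponent does no
  harm.\<close>

lemma q_binomial_Suc_Suc:
  "q_binomial q (Suc n) (Suc k) = q_binomial q n (Suc k) + q ^ (n - k) * q_binomial q n k"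
proof -
  consider "n < k" | "n = k" | "k < n" by linarith
  then show ?thesis
  proof cases
    case 3
    then obtain d where n: "n = Suc (k + d)"
      using less_imp_Suc_add by blast
    have *: "q_int q (Suc n) = q_int q (Suc d) + q ^ Suc d * q_int q (Suc k)"
      using q_int_add[of "Suc d" "Suc k"] by (simp add: n add.commute)
    have "q_binomial q (Suc n) (Suc k) =
        q_int q (Suc n) * q_fact q n / (q_fact q (Suc k) * q_fact q (Suc d))"
      by (simp add: q_binomial_def n q_fact_Suc Suc_diff_le)
    moreover have "q_binomial q n (Suc k) =
        q_int q (Suc d) * q_fact q n / (q_fact q (Suc k) * q_fact q (Suc d))"
      using q_int_neq_0[of "Suc d"] by (simp add: q_binomial_def n q_fact_Suc[of d])
    moreover have "q_binomial q n k =
        q_int q (Suc k) * q_fact q n / (q_fact q (Suc k) * q_fact q (Suc d))"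
      using q_int_neq_0[of "Suc k"] by (simp add: q_binomial_def n q_fact_Suc[of k] Suc_diff_le)
    moreover have "n - k = Suc d"
      by (simp add: n)
    ultimately show ?thesis
      by (simp only: *) (simp add: algebra_simps add_divide_distrib)
  qed (simp_all add: q_binomial_eq_0)
qed

text \<open>For k \<le> n both sides are the q-multinomial coefficient with parts j, k - j, n - k;
  otherwise both are 0.\<close>

lemma q_binomial_trinomial:
  assumes "j \<le> k"
  shows "q_binomial q n k * q_binomial q k j = q_binomial q n j * q_binomial q (n - j) (k - j)"
  using assms by (auto simp: q_binomial_def q_fact_neq_0)

text \<open>Induction on n, applying q-Pascal to [n + 1, j]. The exponent truncates only when m + j
  < k, and then [m, k - j] = 0.\<close>

lemma q_vandermonde:
  "q_binomial q (m + n) k =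
    (\<Sum>j\<le>k. q ^ (j * (m + j - k)) * q_binomial q m (k - j) * q_binomial q n j)"
proof (induction n arbitrary: k)
  case 0
  have "(\<Sum>j\<le>k. q ^ (j * (m + j - k)) * q_binomial q m (k - j) * q_binomial q 0 j) =
      (\<Sum>j\<in>{0}. q ^ (j * (m + j - k)) * q_binomial q m (k - j) * q_binomial q 0 j)"
    by (rule sum.mono_neutral_right) (auto simp: q_binomial_eq_0)
  then show ?case by simp
next
  case (Suc n)
  show ?case
  proof (cases k)
    case (Suc l)
    define T where "T j = q ^ (j * (m + j - k)) * q_binomial q m (k - j)" for j
    \<comment> \<open>The power pulled out does not depend on i and is the one that q-Pascal
      attaches to [m + n, l]. The exponents can be compared only if no subtraction truncates; in the
      remaining cases a binomial on each side is 0.\<close>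
    have shift: "T (Suc i) * (q ^ (n - i) * q_binomial q n i) =
        q ^ (m + n - l) * (q ^ (i * (m + i - l)) * q_binomial q m (l - i) * q_binomial q n i)"
      if "i \<le> l" for i
    proof (cases "l - i \<le> m \<and> i \<le> n")
      case True
      then have "(m + i - l) + (n - i) = m + n - l"
        using that by linarith
      then have "Suc i * (m + i - l) + (n - i) = (m + n - l) + i * (m + i - l)"
        by simp
      then have "q ^ (Suc i * (m + i - l)) * q ^ (n - i) = q ^ (m + n - l) * q ^ (i * (m + i - l))"
        by (simp only: flip: power_add)
      then show ?thesis
        by (simp add: T_def \<open>k = Suc l\<close> del: mult_Suc)
    next
      case False
      then show ?thesis
        using \<open>k = Suc l\<close> by (auto simp: T_def q_binomial_eq_0)
    qed
    have "(\<Sum>j\<le>k. T j * q_binomial q (Suc n) j) =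
        T 0 + (\<Sum>i\<le>l. T (Suc i) * q_binomial q (Suc n) (Suc i))"
      unfolding Suc by (subst sum.atMost_Suc_shift) simp
    also have "\<dots> = (T 0 + (\<Sum>i\<le>l. T (Suc i) * q_binomial q n (Suc i))) +
        (\<Sum>i\<le>l. T (Suc i) * (q ^ (n - i) * q_binomial q n i))"
      by (simp add: q_binomial_Suc_Suc distrib_left sum.distrib)
    also have "T 0 + (\<Sum>i\<le>l. T (Suc i) * q_binomial q n (Suc i)) =
        (\<Sum>j\<le>k. T j * q_binomial q n j)"
      unfolding Suc by (subst sum.atMost_Suc_shift) simp
    also have "\<dots> = q_binomial q (m + n) k"
      by (simp add: Suc.IH[of k] T_def)
    also have "(\<Sum>i\<le>l. T (Suc i) * (q ^ (n - i) * q_binomial q n i)) =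
        q ^ (m + n - l) * q_binomial q (m + n) l"
      unfolding Suc.IH[of l] sum_distrib_left by (rule sum.cong) (simp_all add: shift)
    finally show ?thesis
      by (simp add: T_def Suc q_binomial_Suc_Suc)
  qed simp
qed

lemma q_pfaff_saalschuetz:
  assumes "b \<le> v" "u + v \<le> x + b"
  shows "(\<Sum>s\<le>b. q ^ (s * (v - b + s)) * q_binomial q u s * q_binomial q v (b - s) *
             q_binomial q (x + b - s) (u + v)) =
         q_binomial q x (u + v - b) * q_binomial q (x + b - u) b"
proof -
  \<comment> \<open>The Vandermonde weight for [x + (b - s), u + v] is free of s, so in
    \<open>F\<close> the bracketed factor leaves the sum over s.\<close>
  define E where "E t = q ^ (t * (x + t - (u + v)))" for t
  define F where "F s t = q ^ (s * (v - b + s)) * q_binomial q u s * q_binomial q (v - t) (b - t - s) *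
      (E t * q_binomial q v t * q_binomial q x (u + v - t))" for s t
  have expand: "q ^ (s * (v - b + s)) * q_binomial q u s * q_binomial q v (b - s) *
      q_binomial q (x + b - s) (u + v) = (\<Sum>t\<le>b - s. F s t)" if "s \<le> b" for s
  proof -
    have "q_binomial q (x + b - s) (u + v) =
        (\<Sum>t\<le>u + v. E t * q_binomial q x (u + v - t) * q_binomial q (b - s) t)"
      using q_vandermonde[of x "b - s" "u + v"] that by (simp add: E_def)
    also have "\<dots> = (\<Sum>t\<le>b - s. E t * q_binomial q x (u + v - t) * q_binomial q (b - s) t)"
      using assms by (intro sum.mono_neutral_right) (auto simp: q_binomial_eq_0)
    finally have exp: "q_binomial q (x + b - s) (u + v) = \<dots>" .
    \<comment> \<open>This moves the dependence on s into [v - t, b - t - s], which forms a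
      convolution with [u, s].\<close>
    have "q_binomial q v (b - s) * q_binomial q (b - s) t =
        q_binomial q v t * q_binomial q (v - t) (b - t - s)" if "t \<le> b - s" for t
      using q_binomial_trinomial[OF that, of v] by (simp add: add.commute)
    then show ?thesis
      unfolding exp sum_distrib_left F_def
      by (intro sum.cong refl) (simp add: ac_simps)
  qed
  have inner: "(\<Sum>s\<le>b - t. F s t) =
      q_binomial q x (u + v - b) *
        (E t * q_binomial q (x + b - (u + v)) (b - t) * q_binomial q v t)" if "t \<le> b" for t
  proof -
    \<comment> \<open>The Vandermonde exponent for [(v - t) + u, b - t] turns out to be free of
      t.\<close>
    have "v - t + s - (b - t) = v - b + s" for s
      using that assms by simp
    then have "(\<Sum>s\<le>b - t. q ^ (s * (v - b + s)) * q_binomial q u s * q_binomial q (v - t) (b - t - s)) =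
        q_binomial q (u + v - t) (b - t)"
      using q_vandermonde[of "v - t" u "b - t"] that assms by (simp add: ac_simps)
    \<comment> \<open>With the complementary lower index, the trinomial identity against
      [x, u + v - t] splits off a factor without t.\<close>
    also have "\<dots> = q_binomial q (u + v - t) (u + v - b)"
      using q_binomial_symmetric[of "b - t" "u + v - t"] that assms by simp
    finally have "(\<Sum>s\<le>b - t. F s t) =
        q_binomial q (u + v - t) (u + v - b) * (E t * q_binomial q v t * q_binomial q x (u + v - t))"
      by (simp add: F_def flip: sum_distrib_right)
    moreover have "q_binomial q x (u + v - t) * q_binomial q (u + v - t) (u + v - b) =
        q_binomial q x (u + v - b) * q_binomial q (x + b - (u + v)) (b - t)"
      using q_binomial_trinomial[of "u + v - b" "u + v - t" x] that assms by simp
    ultimately show ?thesis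
      by (simp add: ac_simps)
  qed
  \<comment> \<open>The sums are exchanged over the triangle s + t \<le> b.\<close>
  have "(\<Sum>s\<le>b. \<Sum>t\<le>b - s. F s t) = (\<Sum>s\<le>b. \<Sum>t | t \<le> b \<and> s + t \<le> b. F s t)"
    by (intro sum.cong refl) auto
  also have "\<dots> = (\<Sum>t\<le>b. \<Sum>s | s \<le> b \<and> s + t \<le> b. F s t)"
    using sum.swap_restrict[of "{..b}" "{..b}" F "\<lambda>s t. s + t \<le> b"] by simp
  also have "\<dots> = (\<Sum>t\<le>b. \<Sum>s\<le>b - t. F s t)"
    by (intro sum.cong refl) auto
  finally have swap: "(\<Sum>s\<le>b. \<Sum>t\<le>b - s. F s t) = \<dots>" .
  have "(\<Sum>t\<le>b. E t * q_binomial q (x + b - (u + v)) (b - t) * q_binomial q v t) =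
      q_binomial q (x + b - u) b"
  proof -
    \<comment> \<open>Since u + v \<le> x + b, \<open>E t\<close> is exactly the weight for
      [(x + b - (u + v)) + v, b].\<close>
    have "x + b - (u + v) + t - b = x + t - (u + v)" for t
      using assms by simp
    then show ?thesis
      using q_vandermonde[of "x + b - (u + v)" v b] assms by (simp add: E_def)
  qed
  then show ?thesis
    by (simp add: expand swap inner flip: sum_distrib_left)
qed

lemma q_narayana_expansion:
  assumes "k + m \<le> n" "m \<le> k"
  shows "q_narayana q m n k =
    (\<Sum>s\<le>k - m. q ^ (s * (s + m)) * q_narayana q m k s * q_binomial q (n + k - s - m) (2 * k))"
proof -
  \<comment> \<open>\<open>C\<close> is the part of \<open>q_narayana q m k s\<close> without s; the
    trinomial identity extracts it from the left side too.\<close>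
  define C where "C = q_binomial q (2 * m) m * inverse (q_binomial q k m)"
  have "q_binomial q n k * q_binomial q k m = q_binomial q n m * q_binomial q (n - m) (k - m)"
    using assms by (intro q_binomial_trinomial)
  then have "inverse (q_binomial q n m) * q_binomial q n k =
      inverse (q_binomial q k m) * q_binomial q (n - m) (k - m)"
    using assms by (simp add: q_binomial_neq_0 field_simps)
  then have lhs: "q_narayana q m n k =
      C * (q_binomial q n (k + m) * q_binomial q (n - m) (k - m))"
    by (simp add: q_narayana_def C_def ac_simps)
  have rhs: "q ^ (s * (s + m)) * q_narayana q m k s * q_binomial q (n + k - s - m) (2 * k) =
      C * (q ^ (s * (k - (k - m) + s)) * q_binomial q k s * q_binomial q k (k - m - s) *
        q_binomial q (n + (k - m) - s) (k + k))" if "s \<le> k - m" for s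
  proof -
    \<comment> \<open>Reflecting [k, s + m] produces the factor [v, b - s] with v = k and b = k -
      m.\<close>
    have "q_binomial q k (k - m - s) = q_binomial q k (s + m)"
      using q_binomial_symmetric[of "s + m" k] that assms by (simp add: add.commute)
    moreover have "n + k - s - m = n + (k - m) - s" "k - (k - m) + s = s + m"
      using that assms by simp_all
    ultimately show ?thesis
      by (simp add: q_narayana_def C_def mult_2 mult_2_right ac_simps)
  qed
  have "(\<Sum>s\<le>k - m. q ^ (s * (k - (k - m) + s)) * q_binomial q k s * q_binomial q k (k - m - s) *
      q_binomial q (n + (k - m) - s) (k + k)) =
      q_binomial q n (k + k - (k - m)) * q_binomial q (n + (k - m) - k) (k - m)"
    using assms by (intro q_pfaff_saalschuetz) simp_all
  also have "k + k - (k - m) = k + m"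
    using assms by simp
  also have "n + (k - m) - k = n - m"
    using assms by simp
  finally show ?thesis
    unfolding lhs by (elim subst, subst sum_distrib_left, intro sum.cong refl) (simp only: rhs atMost_iff)
qed

end

text \<open>Powers of the indeterminate are embedded monomials; those of positive degree differ from
  1, and \<open>to_fract\<close> is injective.\<close>

lemma q_generic_q_indet: "q_generic q_indet"
proof
  fix i :: nat
  assume "i > 0"
  have "q_indet ^ i = to_fract (monom 1 i)"
    by (induction i) (simp_all add: q_indet_def monom_Suc flip: to_fract_mult)
  moreover have "monom (1 :: rat) i \<noteq> 1"
    using \<open>i > 0\<close> by (metis degree_1 degree_monom_eq less_numeral_extra(3) zero_neq_one)
  ultimately show "q_indet ^ i \<noteq> 1"
    by (metis to_fract_1 to_fract_eq_iff)
qed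

theorem proposition14:
  fixes m n k :: nat
  assumes "m \<le> n" and "k \<le> n - m" and "m \<le> k"
  shows "q_narayana q_indet m n k =
    (\<Sum>s=0..k - m. q_indet ^ (s * (s + m)) * q_narayana q_indet m k s *
       q_binomial q_indet (n + k - s - m) (2 * k))"
proof -
  interpret q_generic q_indet
    by (rule q_generic_q_indet)
  show ?thesis
    using q_narayana_expansion[of k m n] assms by (simp add: atMost_atLeast0)
qed

end
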